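(* The following dcpos are all dominated: (1) strongly complete partial orders; (2) complete semilattices (dcpos in which every bounded subset has a supremum); (3) complete lattices; (4) dcpos which are sober in their Scott topologies; (5) $\mathsf{Irr}(D)$ for any dcpo $D$.
   Context: For a dcpo $D$: a subset is irreducible if it is nonempty and whenever it is contained in a union $B\cup C$ of two Scott-closed sets it is contained in $B$ or in $C$; "closed irreducible" means Scott-closed and irreducible. $\mathsf{Irr}(D)$ is the set of closed irreducible subsets of $D$ ordered by inclusion. $D$ is strongly complete if every irreducible subset of $D$ has a supremum. For $A',A\in\mathsf{Irr}(D)$ write $A'\triangleleft A$ if there is $x\in A$ with $A'\subseteq{\downarrow}x$, and $\nabla A=\{A'\in\mathsf{Irr}(D)\mid A'\triangleleft A\}$. $D$ is dominated if for every $A\in\mathsf{Irr}(D)$, $\nabla A$ is Scott-closed in the poset $\mathsf{Irr}(D)$. *)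

theory Defs
  imports "HOL-Algebra.Complete_Lattice" "HOL-Analysis.Abstract_Topology"
begin

(* The prefix notation of HOL-Algebra makes the infix closure_of of HOL-Analysis ambiguous. *)
no_notation eq_closure_of (\<open>closure'_of\<index>\<close>)

section \<open>Directed-complete partial orders\<close>

definition directed_in :: "('a, 'b) gorder_scheme \<Rightarrow> 'a set \<Rightarrow> bool" where
  "directed_in D S \<longleftrightarrow>
     S \<subseteq> carrier D \<and> S \<noteq> {} \<and> (\<forall>x\<in>S. \<forall>y\<in>S. \<exists>z\<in>S. x \<sqsubseteq>\<^bsub>D\<^esub> z \<and> y \<sqsubseteq>\<^bsub>D\<^esub> z)"

definition down :: "('a, 'b) gorder_scheme \<Rightarrow> 'a \<Rightarrow> 'a set" where
  "down D x = {y \<in> carrier D. y \<sqsubseteq>\<^bsub>D\<^esub> x}"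

locale dcpo = partial_order D for D (structure) +
  assumes directed_sup_exists: "directed_in D S \<Longrightarrow> \<exists>s. is_lub D s S"

text \<open>The empty set counts as bounded as soon as the carrier is nonempty, so a nonempty
  complete semilattice has a least element.\<close>

locale complete_semilattice = dcpo +
  assumes bounded_sup_exists:
    "\<lbrakk>B \<subseteq> carrier D; Upper D B \<noteq> {}\<rbrakk> \<Longrightarrow> \<exists>s. is_lub D s B"

section \<open>The Scott topology\<close>

text \<open>The Scott topology is used for arbitrary posets, so only those directed sets that have a
  supremum are constrained.\<close>

definition scott_open :: "('a, 'b) gorder_scheme \<Rightarrow> 'a set \<Rightarrow> bool" where
  "scott_open D U \<longleftrightarrow>
     U \<subseteq> carrier D \<and>
     (\<forall>x\<in>U. \<forall>y\<in>carrier D. x \<sqsubseteq>\<^bsub>D\<^esub> y \<longrightarrow> y \<in> U) \<and>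
     (\<forall>S s. directed_in D S \<and> is_lub D s S \<and> s \<in> U \<longrightarrow> S \<inter> U \<noteq> {})"

definition scott_topology :: "('a, 'b) gorder_scheme \<Rightarrow> 'a topology" where
  "scott_topology D = topology (scott_open D)"

lemma scott_openI:
  assumes "U \<subseteq> carrier D"
    and "\<And>x y. \<lbrakk>x \<in> U; y \<in> carrier D; x \<sqsubseteq>\<^bsub>D\<^esub> y\<rbrakk> \<Longrightarrow> y \<in> U"
    and "\<And>S s. \<lbrakk>directed_in D S; is_lub D s S; s \<in> U\<rbrakk> \<Longrightarrow> S \<inter> U \<noteq> {}"
  shows "scott_open D U"
  unfolding scott_open_def
proof (intro conjI ballI allI impI)
  show "U \<subseteq> carrier D" by (rule assms(1))
  show "y \<in> U" if "x \<in> U" "y \<in> carrier D" "x \<sqsubseteq>\<^bsub>D\<^esub> y" for x y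
    using that by (rule assms(2))
  show "S \<inter> U \<noteq> {}" if "directed_in D S \<and> is_lub D s S \<and> s \<in> U" for S s
    using that assms(3)[of S s] by (elim conjE)
qed

lemma istopology_scott_open: "istopology (scott_open D)"
  unfolding istopology_def
proof (intro conjI allI impI)
  fix U V assume U: "scott_open D U" and V: "scott_open D V"
  have sup: "S \<inter> (U \<inter> V) \<noteq> {}"
    if S: "directed_in D S" and s: "is_lub D s S" "s \<in> U \<inter> V" for S s
  proof -
    obtain x where x: "x \<in> S" "x \<in> U"
      using U S s unfolding scott_open_def by blast
    obtain y where y: "y \<in> S" "y \<in> V"
      using V S s unfolding scott_open_def by blast
    obtain z where z: "z \<in> S" "x \<sqsubseteq>\<^bsub>D\<^esub> z" "y \<sqsubseteq>\<^bsub>D\<^esub> z"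
      using S x y unfolding directed_in_def by blast
    have "z \<in> carrier D"
      using S z unfolding directed_in_def by blast
    then have "z \<in> U" "z \<in> V"
      using U V x y z unfolding scott_open_def by blast+
    with z show ?thesis by blast
  qed
  have "U \<inter> V \<subseteq> carrier D"
    using U by (auto simp: scott_open_def)
  moreover have "y \<in> U \<inter> V" if "x \<in> U \<inter> V" "y \<in> carrier D" "x \<sqsubseteq>\<^bsub>D\<^esub> y" for x y
    using that U V by (auto simp: scott_open_def)
  ultimately show "scott_open D (U \<inter> V)"
    using sup by (rule scott_openI)
next
  fix \<K> assume \<K>: "\<forall>K\<in>\<K>. scott_open D K"
  have "\<Union>\<K> \<subseteq> carrier D"
    using \<K> by (auto simp: scott_open_def)
  moreover have "y \<in> \<Union>\<K>" if "x \<in> \<Union>\<K>" "y \<in> carrier D" "x \<sqsubseteq>\<^bsub>D\<^esub> y" for x y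
    using that \<K> unfolding scott_open_def by (metis UnionE UnionI)
  moreover have "S \<inter> \<Union>\<K> \<noteq> {}"
    if S: "directed_in D S" "is_lub D s S" "s \<in> \<Union>\<K>" for S s
  proof -
    obtain K where K: "K \<in> \<K>" "s \<in> K"
      using S by auto
    then have "S \<inter> K \<noteq> {}"
      using S \<K> unfolding scott_open_def by metis
    then show ?thesis
      using K by auto
  qed
  ultimately show "scott_open D (\<Union>\<K>)"
    by (rule scott_openI)
qed

lemma openin_scott_topology [simp]: "openin (scott_topology D) U \<longleftrightarrow> scott_open D U"
  by (simp add: scott_topology_def istopology_scott_open)

lemma topspace_scott_topology [simp]: "topspace (scott_topology D) = carrier D"
proof
  show "topspace (scott_topology D) \<subseteq> carrier D"
    unfolding topspace_def by (auto simp: scott_open_def)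
  have "scott_open D (carrier D)"
    unfolding scott_open_def directed_in_def by blast
  then show "carrier D \<subseteq> topspace (scott_topology D)"
    by (metis openin_scott_topology openin_subset)
qed

lemma closedin_scott_topology_iff:
  "closedin (scott_topology D) C \<longleftrightarrow>
     C \<subseteq> carrier D \<and>
     (\<forall>x\<in>C. \<forall>y\<in>carrier D. y \<sqsubseteq>\<^bsub>D\<^esub> x \<longrightarrow> y \<in> C) \<and>
     (\<forall>S s. directed_in D S \<and> S \<subseteq> C \<and> is_lub D s S \<longrightarrow> s \<in> C)"
proof -
  have lub: "s \<in> carrier D" if "is_lub D s S" for s S
    using that by (auto simp: least_def Upper_def)
  have dir: "S \<subseteq> carrier D" if "directed_in D S" for S
    using that by (auto simp: directed_in_def)
  have upper: "(\<forall>x\<in>carrier D - C. \<forall>y\<in>carrier D. x \<sqsubseteq>\<^bsub>D\<^esub> y \<longrightarrow> y \<in> carrier D - C) \<longleftrightarrow>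
      (\<forall>x\<in>C. \<forall>y\<in>carrier D. y \<sqsubseteq>\<^bsub>D\<^esub> x \<longrightarrow> y \<in> C)" if "C \<subseteq> carrier D"
    using that by (auto dest: subsetD)
  have sup: "(\<forall>S s. directed_in D S \<and> is_lub D s S \<and> s \<in> carrier D - C
        \<longrightarrow> S \<inter> (carrier D - C) \<noteq> {}) \<longleftrightarrow>
      (\<forall>S s. directed_in D S \<and> S \<subseteq> C \<and> is_lub D s S \<longrightarrow> s \<in> C)"
  proof (intro iff_allI)
    fix S s
    show "(directed_in D S \<and> is_lub D s S \<and> s \<in> carrier D - C
        \<longrightarrow> S \<inter> (carrier D - C) \<noteq> {}) \<longleftrightarrow>
      (directed_in D S \<and> S \<subseteq> C \<and> is_lub D s S \<longrightarrow> s \<in> C)"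
      using lub[of s S] dir[of S] by auto
  qed
  show ?thesis
    unfolding closedin_def openin_scott_topology topspace_scott_topology scott_open_def
    using upper sup by auto
qed

section \<open>Irreducible sets, sobriety and strong completeness\<close>

definition irreducible_in :: "'a topology \<Rightarrow> 'a set \<Rightarrow> bool" where
  "irreducible_in X S \<longleftrightarrow>
     S \<subseteq> topspace X \<and> S \<noteq> {} \<and>
     (\<forall>B C. closedin X B \<and> closedin X C \<and> S \<subseteq> B \<union> C \<longrightarrow> S \<subseteq> B \<or> S \<subseteq> C)"

definition sober :: "'a topology \<Rightarrow> bool" where
  "sober X \<longleftrightarrow>
     (\<forall>A. closedin X A \<and> irreducible_in X A \<longrightarrow>
        (\<exists>!x. x \<in> topspace X \<and> A = X closure_of {x}))"

text \<open>Directed sets are irreducible, so a strongly complete partial order is in particular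
  a dcpo.\<close>

locale strongly_complete = partial_order D for D (structure) +
  assumes irreducible_sup_exists:
    "irreducible_in (scott_topology D) S \<Longrightarrow> \<exists>s. is_lub D s S"

section \<open>Dominated dcpos\<close>

definition Irr :: "('a, 'b) gorder_scheme \<Rightarrow> 'a set set" where
  "Irr D = {A. closedin (scott_topology D) A \<and> irreducible_in (scott_topology D) A}"

definition Irr_order :: "('a, 'b) gorder_scheme \<Rightarrow> 'a set gorder" where
  "Irr_order D = \<lparr>carrier = Irr D, eq = (=), le = (\<subseteq>)\<rparr>"

definition bounded_within :: "('a, 'b) gorder_scheme \<Rightarrow> 'a set \<Rightarrow> 'a set \<Rightarrow> bool"
  (\<open>(_ \<triangleleft>\<index> _)\<close> [51, 51] 50) where
  "A' \<triangleleft>\<^bsub>D\<^esub> A \<longleftrightarrow> (\<exists>x\<in>A. A' \<subseteq> down D x)"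

definition nabla :: "('a, 'b) gorder_scheme \<Rightarrow> 'a set \<Rightarrow> 'a set set" where
  "nabla D A = {A' \<in> Irr D. A' \<triangleleft>\<^bsub>D\<^esub> A}"

locale dominated = dcpo +
  assumes nabla_closed:
    "A \<in> Irr D \<Longrightarrow> closedin (scott_topology (Irr_order D)) (nabla D A)"

end

(* If every bounded closed irreducible subset of D has a supremum, D is dominated: for a directed
   family in nabla A, the suprema of its members lie in A and form a directed set, whose supremum
   is again in A and bounds every member, hence also the supremum of the family in Irr(D).
   The first four classes satisfy this condition outright.  Moreover Irr(D) is strongly complete,
   the supremum of an irreducible family being the closure of its union. *)

theory Submission
  imports Defs
begin

section \<open>Suprema, irreducible sets and principal ideals\<close>

text \<open>\<open>Upper\<close> tests only those elements of \<open>S\<close> that lie in the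
  carrier; the hypothesis removes this relativisation.\<close>

lemma is_lub_iff:
  assumes "S \<subseteq> carrier D"
  shows "is_lub D s S \<longleftrightarrow> s \<in> carrier D \<and> (\<forall>x\<in>S. x \<sqsubseteq>\<^bsub>D\<^esub> s) \<and>
    (\<forall>u\<in>carrier D. (\<forall>x\<in>S. x \<sqsubseteq>\<^bsub>D\<^esub> u) \<longrightarrow> s \<sqsubseteq>\<^bsub>D\<^esub> u)"
  using assms by (auto simp: least_def Upper_def subset_iff)

text \<open>A point of \<open>S\<close> outside \<open>B\<close> and one outside \<open>C\<close>
  have a common upper bound in \<open>S\<close>. As Scott-closed sets are lower sets, that bound
  lies in neither.\<close>

lemma irreducible_in_directed:
  assumes S: "directed_in D S"
  shows "irreducible_in (scott_topology D) S"
  unfolding irreducible_in_def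
proof (intro conjI allI impI)
  show "S \<subseteq> topspace (scott_topology D)" "S \<noteq> {}"
    using S by (auto simp: directed_in_def)
  fix B C
  assume BC: "closedin (scott_topology D) B \<and> closedin (scott_topology D) C \<and> S \<subseteq> B \<union> C"
  show "S \<subseteq> B \<or> S \<subseteq> C"
  proof (rule ccontr)
    assume "\<not> (S \<subseteq> B \<or> S \<subseteq> C)"
    then obtain x y where xy: "x \<in> S" "x \<notin> B" "y \<in> S" "y \<notin> C"
      by blast
    then obtain z where z: "z \<in> S" "x \<sqsubseteq>\<^bsub>D\<^esub> z" "y \<sqsubseteq>\<^bsub>D\<^esub> z"
      using S unfolding directed_in_def by blast
    have "x \<in> carrier D" "y \<in> carrier D"
      using S xy by (auto simp: directed_in_def)
    then have "z \<notin> B" "z \<notin> C"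
      using BC xy z unfolding closedin_scott_topology_iff by blast+
    with z BC show False
      by blast
  qed
qed

text \<open>A closed set contains \<open>S\<close> exactly when it contains the closure of
  \<open>S\<close>, so the choice between \<open>B\<close> and \<open>C\<close> is the same for both
  sets.\<close>

lemma irreducible_in_closure_of:
  assumes "irreducible_in X S"
  shows "irreducible_in X (X closure_of S)"
  using assms closure_of_subset[of S X] closure_of_subset_topspace[of X S]
  unfolding irreducible_in_def by (metis closure_of_minimal subset_empty subset_trans)

lemma (in partial_order) closedin_down:
  assumes "x \<in> carrier L"
  shows "closedin (scott_topology L) (down L x)"
  unfolding closedin_scott_topology_iff
proof (intro conjI ballI allI impI)
  show "down L x \<subseteq> carrier L"
    by (auto simp: down_def)
  show "z \<in> down L x" if "y \<in> down L x" "z \<in> carrier L" "z \<sqsubseteq> y" for y z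
    using that assms le_trans[of z y x] by (simp add: down_def)
  show "s \<in> down L x" if "directed_in L S \<and> S \<subseteq> down L x \<and> is_lub L s S" for S s
  proof -
    have "S \<subseteq> carrier L"
      using that by (simp add: directed_in_def)
    with that assms show ?thesis
      by (auto simp: is_lub_iff down_def)
  qed
qed

text \<open>A Scott-closed set containing \<open>x\<close> contains the whole ideal, so of two such
  sets covering the ideal, one that contains \<open>x\<close> suffices.\<close>

lemma (in partial_order) down_in_Irr:
  assumes "x \<in> carrier L"
  shows "down L x \<in> Irr L"
proof -
  have "x \<in> down L x" "down L x \<subseteq> carrier L"
    using assms by (auto simp: down_def)
  moreover have "down L x \<subseteq> B" if "closedin (scott_topology L) B" "x \<in> B" for B
    using that by (auto simp: closedin_scott_topology_iff down_def)
  ultimately show ?thesis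
    using closedin_down[OF assms]
    unfolding Irr_def irreducible_in_def topspace_scott_topology by blast
qed

section \<open>The order on \<open>Irr D\<close> and the criterion for domination\<close>

lemma carrier_Irr_order [simp]: "carrier (Irr_order D) = Irr D"
  and le_Irr_order [simp]: "A \<sqsubseteq>\<^bsub>Irr_order D\<^esub> B \<longleftrightarrow> A \<subseteq> B"
  by (simp_all add: Irr_order_def)

lemma partial_order_Irr_order: "partial_order (Irr_order D)"
  by unfold_locales (auto simp: Irr_order_def)

lemma (in dcpo) dominatedI:
  assumes sup: "\<And>A x. \<lbrakk>A \<in> Irr D; x \<in> carrier D; A \<subseteq> down D x\<rbrakk> \<Longrightarrow> \<exists>s. is_lub D s A"
  shows "dominated D"
proof unfold_locales
  fix A assume A: "A \<in> Irr D"
  then have closed: "closedin (scott_topology D) A"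
    by (simp add: Irr_def)
  then have sub: "A \<subseteq> carrier D"
    by (simp add: closedin_scott_topology_iff)
  \<comment> \<open>The bounding point \<open>x\<close> of \<open>A\<close> is an upper bound of
    \<open>A'\<close>, so the supremum lies below \<open>x\<close>, and \<open>A\<close> is a lower
    set.\<close>
  have lub: "\<exists>s\<in>A. is_lub D s A'" if A': "A' \<in> nabla D A" for A'
  proof -
    obtain x where x: "x \<in> A" "A' \<subseteq> down D x" and Irr: "A' \<in> Irr D"
      using A' by (auto simp: nabla_def bounded_within_def)
    then obtain s where s: "is_lub D s A'"
      using sup sub by blast
    have "A' \<subseteq> carrier D"
      using Irr by (simp add: Irr_def closedin_scott_topology_iff)
    with s x sub have "s \<in> carrier D" "s \<sqsubseteq> x"
      by (auto simp: is_lub_iff down_def)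
    with x closed have "s \<in> A"
      by (auto simp: closedin_scott_topology_iff)
    with s show ?thesis ..
  qed
  show "closedin (scott_topology (Irr_order D)) (nabla D A)"
    unfolding closedin_scott_topology_iff
  proof (intro conjI ballI allI impI)
    show "nabla D A \<subseteq> carrier (Irr_order D)"
      by (auto simp: nabla_def)
    show "Z \<in> nabla D A"
      if "Y \<in> nabla D A" "Z \<in> carrier (Irr_order D)" "Z \<sqsubseteq>\<^bsub>Irr_order D\<^esub> Y" for Y Z
      using that by (auto simp: nabla_def bounded_within_def)
    fix \<S> T
    assume asm: "directed_in (Irr_order D) \<S> \<and> \<S> \<subseteq> nabla D A \<and> is_lub (Irr_order D) T \<S>"
    then have Irr: "\<S> \<subseteq> Irr D" and T: "is_lub (Irr_order D) T \<S>"
      by (auto simp: directed_in_def)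
    \<comment> \<open>\<open>f\<close> chooses a supremum in \<open>A\<close> for each member. It is
      monotone, since \<open>f Z\<close> bounds every \<open>Y\<close> included in \<open>Z\<close>,
      and therefore sends the directed family to a directed subset of \<open>A\<close>.\<close>
    obtain f where f: "f Y \<in> A" "is_lub D (f Y) Y" if "Y \<in> \<S>" for Y
      using lub asm by (metis subsetD)
    have carr: "Y \<subseteq> carrier D" if "Y \<in> \<S>" for Y
      using that Irr by (auto simp: Irr_def closedin_scott_topology_iff)
    have upper: "x \<sqsubseteq> f Y" if "Y \<in> \<S>" "x \<in> Y" for x Y
      using that f carr by (simp add: is_lub_iff)
    have mono: "f Y \<sqsubseteq> f Z" if "Y \<in> \<S>" "Z \<in> \<S>" "Y \<subseteq> Z" for Y Z
    proof -
      have "f Z \<in> carrier D" "\<forall>x\<in>Y. x \<sqsubseteq> f Z"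
        using that f sub upper by auto
      then show ?thesis
        using f(2)[OF that(1)] carr[OF that(1)] by (simp add: is_lub_iff)
    qed
    have dir: "directed_in D (f ` \<S>)"
      unfolding directed_in_def
    proof (intro conjI ballI)
      show "f ` \<S> \<subseteq> carrier D" "f ` \<S> \<noteq> {}"
        using f(1) sub asm unfolding directed_in_def by blast+
      fix x y assume "x \<in> f ` \<S>" "y \<in> f ` \<S>"
      then obtain X Y where XY: "X \<in> \<S>" "x = f X" "Y \<in> \<S>" "y = f Y"
        by blast
      then obtain Z where "Z \<in> \<S>" "X \<subseteq> Z" "Y \<subseteq> Z"
        using asm unfolding directed_in_def le_Irr_order by blast
      with XY show "\<exists>z\<in>f ` \<S>. x \<sqsubseteq> z \<and> y \<sqsubseteq> z"
        using mono[of X Z] mono[of Y Z] by blast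
    qed
    then obtain a where a: "is_lub D a (f ` \<S>)"
      using directed_sup_exists by blast
    moreover have "f ` \<S> \<subseteq> A"
      using f(1) by blast
    ultimately have "a \<in> A"
      using closed dir unfolding closedin_scott_topology_iff by blast
    have a_carr: "a \<in> carrier D" and ub: "\<And>Y. Y \<in> \<S> \<Longrightarrow> f Y \<sqsubseteq> a"
      using a dir by (auto simp: is_lub_iff directed_in_def)
    have "Y \<subseteq> down D a" if Y: "Y \<in> \<S>" for Y
    proof
      fix x assume "x \<in> Y"
      then have "x \<in> carrier D" "x \<sqsubseteq> f Y" "f Y \<in> carrier D"
        using upper[OF Y] carr[OF Y] f(1)[OF Y] sub by blast+
      then show "x \<in> down D a"
        using le_trans[of x "f Y" a] ub[OF Y] a_carr by (simp add: down_def)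
    qed
    \<comment> \<open>\<open>down D a\<close> is itself in \<open>Irr D\<close>, hence an upper
      bound of the family there, and the least upper bound \<open>T\<close> is included in
      it.\<close>
    then have "T \<subseteq> down D a" "T \<in> Irr D"
      using T Irr down_in_Irr[OF a_carr] by (auto simp: is_lub_iff)
    with \<open>a \<in> A\<close> show "T \<in> nabla D A"
      by (auto simp: nabla_def bounded_within_def)
  qed
qed

section \<open>The first four classes\<close>

text \<open>Makes the criterion \<open>dominatedI\<close>, which is stated for dcpos, available for
  strongly complete orders.\<close>

sublocale strongly_complete \<subseteq> dcpo
  by unfold_locales (rule irreducible_sup_exists, rule irreducible_in_directed)

lemma (in strongly_complete) dominated: "dominated D"
  by (rule dominatedI) (simp add: Irr_def irreducible_sup_exists)

lemma (in complete_semilattice) dominated: "dominated D"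
proof (rule dominatedI)
  fix A x assume "A \<in> Irr D" "x \<in> carrier D" "A \<subseteq> down D x"
  then have "A \<subseteq> carrier D" "x \<in> Upper D A"
    by (auto simp: Upper_def down_def)
  then show "\<exists>s. is_lub D s A"
    using bounded_sup_exists by blast
qed

lemma (in complete_lattice) complete_semilattice: "complete_semilattice L"
  by unfold_locales (auto simp: directed_in_def intro: sup_exists)

text \<open>Sobriety makes every closed irreducible set the closure of a point. This closure lies
  inside the principal ideal of the point, which is thus a greatest element and so the
  supremum.\<close>

lemma (in dcpo) sober_imp_dominated:
  assumes "sober (scott_topology D)"
  shows "dominated D"
proof (rule dominatedI)
  fix A assume "A \<in> Irr D"
  then obtain x where x: "x \<in> carrier D" "A = scott_topology D closure_of {x}"
    using assms unfolding sober_def Irr_def topspace_scott_topology by blast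
  have "x \<in> A"
    using x closure_of_subset[of "{x}" "scott_topology D"] by simp
  moreover have "A \<subseteq> down D x"
    unfolding x(2) by (rule closure_of_minimal) (use x closedin_down in \<open>simp_all add: down_def\<close>)
  moreover from this have "A \<subseteq> carrier D"
    by (auto simp: down_def)
  ultimately have "is_lub D x A"
    using x by (auto simp: is_lub_iff down_def)
  then show "\<exists>s. is_lub D s A" ..
qed

section \<open>Strong completeness of \<open>Irr D\<close>\<close>

text \<open>Elements of \<open>Irr D\<close> are closed, so an upper bound of the family contains
  the closure of its union; irreducibility of the union puts this closure in \<open>Irr D\<close>.
  Serves directed and irreducible families alike.\<close>

lemma is_lub_Irr_order_closure:
  assumes "\<S> \<subseteq> Irr D" and irr: "irreducible_in (scott_topology D) (\<Union>\<S>)"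
  shows "is_lub (Irr_order D) (scott_topology D closure_of \<Union>\<S>) \<S>"
proof -
  let ?X = "scott_topology D"
  have "?X closure_of \<Union>\<S> \<in> Irr D"
    using irreducible_in_closure_of[OF irr] by (simp add: Irr_def)
  moreover have "\<Union>\<S> \<subseteq> ?X closure_of \<Union>\<S>"
    using irr by (intro closure_of_subset) (simp add: irreducible_in_def)
  moreover have "?X closure_of \<Union>\<S> \<subseteq> U" if "U \<in> Irr D" "\<forall>Y\<in>\<S>. Y \<subseteq> U" for U
    using that by (intro closure_of_minimal) (auto simp: Irr_def)
  ultimately show ?thesis
    using assms(1) by (simp add: is_lub_iff Sup_le_iff)
qed

text \<open>If one member is not inside \<open>B\<close> and another is not inside \<open>C\<close>,
  a member above both is inside neither, against its own irreducibility.\<close>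

lemma irreducible_in_directed_Union:
  assumes dir: "directed_in (Irr_order D) \<S>"
  shows "irreducible_in (scott_topology D) (\<Union>\<S>)"
  unfolding irreducible_in_def
proof (intro conjI allI impI)
  have irr: "irreducible_in (scott_topology D) Y" if "Y \<in> \<S>" for Y
    using that dir by (auto simp: directed_in_def Irr_def)
  then have sub: "Y \<subseteq> topspace (scott_topology D)" "Y \<noteq> {}" if "Y \<in> \<S>" for Y
    using that unfolding irreducible_in_def by metis+
  have "\<S> \<noteq> {}"
    using dir unfolding directed_in_def by metis
  with sub show "\<Union>\<S> \<subseteq> topspace (scott_topology D)" "\<Union>\<S> \<noteq> {}"
    by blast+
  fix B C
  assume BC: "closedin (scott_topology D) B \<and> closedin (scott_topology D) C \<and> \<Union>\<S> \<subseteq> B \<union> C"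
  show "\<Union>\<S> \<subseteq> B \<or> \<Union>\<S> \<subseteq> C"
  proof (rule ccontr)
    assume "\<not> (\<Union>\<S> \<subseteq> B \<or> \<Union>\<S> \<subseteq> C)"
    then obtain Y Z where YZ: "Y \<in> \<S>" "\<not> Y \<subseteq> B" "Z \<in> \<S>" "\<not> Z \<subseteq> C"
      by blast
    then obtain W where W: "W \<in> \<S>" "Y \<subseteq> W" "Z \<subseteq> W"
      using dir unfolding directed_in_def le_Irr_order by blast
    then have "W \<subseteq> B \<or> W \<subseteq> C"
      using irr BC unfolding irreducible_in_def by (meson Union_upper subset_trans)
    with YZ W show False
      by blast
  qed
qed

text \<open>Carries closed sets of \<open>D\<close> over to \<open>Irr D\<close>, so that
  irreducibility of a family can be tested against them. A directed supremum is included in the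
  closure of the union, which stays inside the closed set \<open>B\<close>.\<close>

lemma closedin_Irr_order_subsets:
  assumes B: "closedin (scott_topology D) B"
  shows "closedin (scott_topology (Irr_order D)) {A \<in> Irr D. A \<subseteq> B}"
  unfolding closedin_scott_topology_iff[of "Irr_order D"]
proof (intro conjI ballI allI impI)
  fix \<S> T
  assume asm: "directed_in (Irr_order D) \<S> \<and> \<S> \<subseteq> {A \<in> Irr D. A \<subseteq> B} \<and>
    is_lub (Irr_order D) T \<S>"
  then have Irr: "\<S> \<subseteq> Irr D"
    by auto
  let ?K = "scott_topology D closure_of \<Union>\<S>"
  have "is_lub (Irr_order D) ?K \<S>"
    using asm Irr by (auto intro: is_lub_Irr_order_closure irreducible_in_directed_Union)
  then have "T \<subseteq> ?K" "T \<in> Irr D"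
    using asm Irr by (auto simp: is_lub_iff)
  moreover have "?K \<subseteq> B"
    using asm B by (intro closure_of_minimal) auto
  ultimately show "T \<in> {A \<in> Irr D. A \<subseteq> B}"
    by blast
qed auto

lemma strongly_complete_Irr_order: "strongly_complete (Irr_order D)"
proof -
  interpret partial_order "Irr_order D"
    by (rule partial_order_Irr_order)
  show ?thesis
  proof unfold_locales
    fix \<S> assume \<S>: "irreducible_in (scott_topology (Irr_order D)) \<S>"
    then have Irr: "\<S> \<subseteq> Irr D" and ne: "\<S> \<noteq> {}"
      by (auto simp: irreducible_in_def)
    have irr: "irreducible_in (scott_topology D) Y" if "Y \<in> \<S>" for Y
      using that Irr by (auto simp: Irr_def)
    have "irreducible_in (scott_topology D) (\<Union>\<S>)"
      unfolding irreducible_in_def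
    proof (intro conjI allI impI)
      have "Y \<subseteq> topspace (scott_topology D)" "Y \<noteq> {}" if "Y \<in> \<S>" for Y
        using irr[OF that] unfolding irreducible_in_def by metis+
      with ne show "\<Union>\<S> \<subseteq> topspace (scott_topology D)" "\<Union>\<S> \<noteq> {}"
        by blast+
      fix B C
      assume BC: "closedin (scott_topology D) B \<and> closedin (scott_topology D) C \<and> \<Union>\<S> \<subseteq> B \<union> C"
      \<comment> \<open>Irreducibility acts on two levels: that of each member sorts it into
        \<open>B\<close> or \<open>C\<close>, which covers the family by two closed subsets of
        \<open>Irr D\<close>; that of the family then selects one of the two.\<close>
      have "Y \<subseteq> B \<or> Y \<subseteq> C" if "Y \<in> \<S>" for Y
        using irr[OF that] BC that unfolding irreducible_in_def by (meson Union_upper subset_trans)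
      then have "\<S> \<subseteq> {A \<in> Irr D. A \<subseteq> B} \<union> {A \<in> Irr D. A \<subseteq> C}"
        using Irr by blast
      then have "\<S> \<subseteq> {A \<in> Irr D. A \<subseteq> B} \<or> \<S> \<subseteq> {A \<in> Irr D. A \<subseteq> C}"
        using \<S>[unfolded irreducible_in_def] closedin_Irr_order_subsets[of D B]
          closedin_Irr_order_subsets[of D C] BC by blast
      then show "\<Union>\<S> \<subseteq> B \<or> \<Union>\<S> \<subseteq> C"
        by blast
    qed
    then show "\<exists>T. is_lub (Irr_order D) T \<S>"
      using Irr is_lub_Irr_order_closure by blast
  qed
qed

theorem theorem2p15:
  fixes D :: "('a, 'b) gorder_scheme"
  shows "(strongly_complete D \<longrightarrow> dominated D) \<and>
         (complete_semilattice D \<longrightarrow> dominated D) \<and>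
         (complete_lattice D \<longrightarrow> dominated D) \<and>
         (dcpo D \<and> sober (scott_topology D) \<longrightarrow> dominated D) \<and>
         (dcpo D \<longrightarrow> dominated (Irr_order D))"
  \<comment> \<open>Complete lattices are treated as complete semilattices, and the last class is
    the strongly complete case applied to \<open>Irr_order D\<close>.\<close>
  by (simp add: strongly_complete.dominated complete_semilattice.dominated
      complete_lattice.complete_semilattice dcpo.sober_imp_dominated strongly_complete_Irr_order)

end
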